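(* For every integer $m\ge 1$, $$\mathrm{m}_\mathbb{D}(x_1\cdots x_m+y)=\frac{1}{2^{m+1}}-\frac{1}{2}.$$ For all integers $m,n\ge 2$, \begin{align*} \mathrm{m}_\mathbb{D}(x_1\cdots x_m+y_1\cdots y_n)=&\frac{1}{4}+\binom{m+n-2}{m-1}\frac{1}{2^{m+n}}-\frac{1}{2^{m+n}} \sum_{r=0}^{n-1} \binom{m+n-3-r}{m-2} 2^r-\frac{1}{2^{m+n}} \sum_{r=0}^{m-1} \binom{m+n-3-r}{n-2} 2^r\\ &-\frac{m}{2^{m+n+1}}\sum_{r=0}^{n-1} \binom{m+n-1-r}{m} 2^r-\frac{n}{2^{m+n+1}} \sum_{r=0}^{m-1} \binom{m+n-1-r}{n} 2^r. \end{align*}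
   Context: For a nonzero rational function $P\in\mathbb{C}(x_1,\dots,x_n)$ in $n$ variables, the (logarithmic) areal Mahler measure is $\mathrm{m}_\mathbb{D}(P)=\frac{1}{\pi^n}\int_{\mathbb{D}^n}\log|P|\,dA(x_1)\cdots dA(x_n)$, where $\mathbb{D}=\{x\in\mathbb{C}:|x|\le 1\}$ and $dA$ is Lebesgue (area) measure on $\mathbb{C}$; here the polynomials are in the $m+n$ independent variables $x_1,\dots,x_m,y_1,\dots,y_n$ (respectively $m+1$ variables $x_1,\dots,x_m,y$). Binomial coefficients $\binom{a}{b}$ with $b>a\ge0$ are $0$. *)

theory Defs
  imports "HOL-Analysis.Analysis"
begin

definition disk_measure :: "complex measure" where
  "disk_measure = restrict_space lborel (cball 0 1)"

definition areal_mahler :: "nat \<Rightarrow> ((nat \<Rightarrow> complex) \<Rightarrow> complex) \<Rightarrow> real" where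
  "areal_mahler k P =
     (1 / pi ^ k) * (\<integral>x. ln (cmod (P x)) \<partial>(PiM {..<k} (\<lambda>_. disk_measure)))"

end

theory Submission
  imports Defs "HOL-Probability.Probability" "HOL-Complex_Analysis.Complex_Analysis"
begin

text \<open>
  By rotation invariance and Jensen's formula, \<open>ln |X + Y|\<close> may be replaced under the integral by
  \<open>ln (max |X| |Y|)\<close>, where \<open>X\<close> and \<open>Y\<close> are the two products. For a uniform point \<open>x\<close> of the disk,
  \<open>- ln |x|\<close> is exponentially distributed with rate 2, so \<open>- ln |X|\<close> and \<open>- ln |Y|\<close> are independent
  Gamma variables \<open>U\<close> and \<open>V\<close> of shapes \<open>m\<close> and \<open>n\<close>, and the Mahler measure is
  \<open>- E (min U V) = - \<integral> P (U > t) P (V > t) dt = - (\<Sum>i<m. \<Sum>j<n. (i + j choose i) / 2 ^ (i + j + 2))\<close>.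
  The stated closed form follows from recurrences for the row sums of this double sum.
\<close>

section \<open>Binomial sums\<close>

text \<open>A negative binomial probability: in fair coin tosses, fewer than \<open>n\<close> tails
  precede the head number \<open>m + 1\<close>.\<close>

definition binom_row_sum :: "nat \<Rightarrow> nat \<Rightarrow> real" where
  "binom_row_sum m n = (\<Sum>j<n. real ((m + j) choose j) / 2 ^ (m + j + 1))"

lemma binom_row_sum_Suc_right:
  "binom_row_sum m (Suc n) = binom_row_sum m n + real ((m + n) choose n) / 2 ^ (m + n + 1)"
  by (simp add: binom_row_sum_def)

text \<open>In coin tosses, the subtracted term is the probability that exactly \<open>m + 1\<close>
  heads precede the tail number \<open>n\<close>. Formally, Pascal's rule applied to both new
  binomials carries the induction on \<open>n\<close>.\<close>

lemma binom_row_sum_Suc_left: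
  "binom_row_sum (Suc m) n = binom_row_sum m n - real ((m + n) choose Suc m) / 2 ^ (m + n + 1)"
proof (induction n)
  case 0
  show ?case by (simp add: binom_row_sum_def)
next
  case (Suc n)
  have "(Suc m + n) choose n = (m + n choose n) + (if n = 0 then 0 else (m + n) choose (n - 1))"
    by (cases n) auto
  moreover have "(m + Suc n) choose Suc m = (m + n choose n) + (m + n choose Suc m)"
    using binomial_symmetric[of m "m + n"] by simp
  moreover have "(if n = 0 then 0 else (m + n) choose (n - 1)) = (m + n choose Suc m)"
    using binomial_symmetric[of "Suc m" "m + n"] by (cases n) auto
  ultimately show ?case
    using Suc by (simp add: binom_row_sum_Suc_right add_divide_distrib)
qed

text \<open>Among \<open>m + n\<close> fair tosses there are more than \<open>m\<close> heads, or
  more than \<open>n\<close> tails, or exactly \<open>m\<close> heads and \<open>n\<close> tails.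
  The row sums are the probabilities of the first two events.\<close>

lemma binom_row_sum_swap: "binom_row_sum m n + binom_row_sum n m = 1 - real ((m + n) choose m) / 2 ^ (m + n)"
proof (induction m)
  case 0
  have "binom_row_sum 0 n = 1 - 1 / 2 ^ n" by (induction n) (auto simp: binom_row_sum_def field_simps)
  then show ?case by (simp add: binom_row_sum_def)
next
  case (Suc m)
  have "(n + m) choose m = (n + m) choose n"
    using binomial_symmetric[of m "n + m"] by simp
  then show ?case using Suc
    by (simp add: binom_row_sum_Suc_right binom_row_sum_Suc_left add_divide_distrib add.commute[of n m])
qed

text \<open>The substitution \<open>r\<close> to \<open>n - 1 - r\<close> turns sums of the shape
  found in the theorem into row sums.\<close>

lemma binom_row_sum_reverse:
  "(1 / 2 ^ (m + n)) * (\<Sum>r<n. real ((m + n - 1 - r) choose m) * 2 ^ r) = binom_row_sum m n"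
proof -
  have "(\<Sum>r<n. real ((m + n - 1 - r) choose m) * 2 ^ r)
     = (\<Sum>r<n. real ((m + n - 1 - (n - 1 - r)) choose m) * 2 ^ (n - 1 - r))"
    by (subst sum.nat_diff_reindex[symmetric]) simp
  also have "(1 / 2 ^ (m + n)) * \<dots> = binom_row_sum m n"
    unfolding binom_row_sum_def sum_distrib_left
  proof (rule sum.cong)
    fix r assume "r \<in> {..<n}"
    then have r: "m + n = (n - 1 - r) + (m + r + 1)" "m + n - 1 - (n - 1 - r) = m + r" by auto
    have "(2::real) ^ (m + n) = 2 ^ (n - 1 - r) * 2 ^ (m + r + 1)"
      by (subst r(1)) (rule power_add)
    then show "1 / 2 ^ (m + n) * (real (m + n - 1 - (n - 1 - r) choose m) * 2 ^ (n - 1 - r)) =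
       real (m + r choose r) / 2 ^ (m + r + 1)"
      using binomial_symmetric[of m "m + r"] by (simp only: r(2)) (simp add: field_simps)
  qed simp
  finally show ?thesis .
qed

definition binom_box_sum :: "nat \<Rightarrow> nat \<Rightarrow> real" where
  "binom_box_sum m n = (\<Sum>i<m. \<Sum>j<n. real ((i + j) choose i) / 2 ^ (i + j + 2))"

lemma binom_box_sum_Suc: "binom_box_sum (Suc m) n = binom_box_sum m n + binom_row_sum m n / 2"
proof -
  have "(m + j) choose m = (m + j) choose j" for j
    using binomial_symmetric[of m "m + j"] by simp
  then show ?thesis
    by (simp add: binom_box_sum_def binom_row_sum_def sum_divide_distrib mult.commute)
qed

lemma binom_box_sum_nonneg: "0 \<le> binom_box_sum m n"
  unfolding binom_box_sum_def by (intro sum_nonneg) simp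

text \<open>Only \<open>j = 0\<close> occurs, which leaves a geometric sum over
  \<open>i\<close>.\<close>

lemma binom_box_sum_one: "- binom_box_sum m 1 = 1 / 2 ^ (m + 1) - 1 / 2"
proof (induction m)
  case (Suc m)
  have "binom_row_sum m 1 = 1 / 2 ^ (m + 1)" by (simp add: binom_row_sum_def)
  then show ?case using Suc by (simp add: binom_box_sum_Suc)
qed (simp add: binom_box_sum_def)

text \<open>In the induction on \<open>m\<close>, moving both row sums to \<open>Suc m\<close>
  produces two boundary terms. The weights \<open>m\<close> and \<open>n\<close> make them cancel,
  by the absorption identity for binomial coefficients.\<close>

lemma binom_box_sum_eq: "binom_box_sum m n = real m / 2 * binom_row_sum m n + real n / 2 * binom_row_sum n m"
proof (induction m)
  case 0
  show ?case by (simp add: binom_box_sum_def binom_row_sum_def)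
next
  case (Suc m)
  have "Suc m * (m + n choose Suc m) = n * (m + n choose m)"
    using binomial_absorb_comp[of "m + n" m] binomial_absorption[of m "m + n"] by simp
  then have *: "real (Suc m) * real (m + n choose Suc m) = real n * real (m + n choose m)"
    by (metis of_nat_mult)
  have "binom_box_sum (Suc m) n = real m / 2 * binom_row_sum m n + real n / 2 * binom_row_sum n m + binom_row_sum m n / 2"
    using Suc by (simp add: binom_box_sum_Suc)
  also have "\<dots> = real (Suc m) / 2 * binom_row_sum (Suc m) n + real n / 2 * binom_row_sum n (Suc m)
     + (real (Suc m) * real (m + n choose Suc m) - real n * real (m + n choose m)) / 2 ^ (m + n + 2)"
    by (simp add: binom_row_sum_Suc_right binom_row_sum_Suc_left field_simps)
  finally show ?case by (simp only: *) simp
qed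

text \<open>Among \<open>p + q + 2\<close> fair tosses there are more than \<open>p\<close> heads or
  more than \<open>q\<close> tails, and both happen exactly for \<open>p + 1\<close> heads and
  \<open>q + 1\<close> tails. So the two probabilities add up to 1 plus that of the overlap.\<close>

lemma binom_row_sum_shift:
  "binom_row_sum p (q + 2) + binom_row_sum q (p + 2) = 1 + real ((p + q + 2) choose (p + 1)) / 2 ^ (p + q + 2)"
proof -
  have s: "(p + q + 1) choose (q + 1) = (p + q + 1) choose p"
    "(q + p + 2) choose (q + 1) = (p + q + 2) choose (p + 1)"
    using binomial_symmetric[of p "p + q + 1"] binomial_symmetric[of "p + 1" "p + q + 2"]
    by (auto simp: add.commute)
  \<comment> \<open>The indices are moved one at a time towards \<open>binom_row_sum_swap\<close> at
    \<open>p\<close> and \<open>q + 1\<close>.\<close>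
  have 1: "binom_row_sum p (q + 2) = binom_row_sum p (q + 1) + real ((p + q + 1) choose (q + 1)) / 2 ^ (p + q + 2)"
    using binom_row_sum_Suc_right[of p "q + 1"] by (simp add: add.assoc)
  have 2: "binom_row_sum q (p + 2) = binom_row_sum (q + 1) (p + 2) + real ((q + p + 2) choose (q + 1)) / 2 ^ (p + q + 3)"
    using binom_row_sum_Suc_left[of q "p + 2"]
    by (simp add: power_add mult.commute[of "2 ^ p"] add.commute add.left_commute)
  have 3: "binom_row_sum (q + 1) (p + 2) = binom_row_sum (q + 1) p + real ((p + q + 1) choose p) / 2 ^ (p + q + 2)
     + real ((p + q + 2) choose (p + 1)) / 2 ^ (p + q + 3)"
    using binom_row_sum_Suc_right[of "q + 1" p] binom_row_sum_Suc_right[of "q + 1" "p + 1"]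
    by (simp add: power_add mult.commute[of "2 ^ p"] add.commute add.left_commute)
  have 4: "binom_row_sum p (q + 1) + binom_row_sum (q + 1) p = 1 - real ((p + q + 1) choose p) / 2 ^ (p + q + 1)"
    using binom_row_sum_swap[of p "q + 1"] by (simp add: ac_simps)
  \<comment> \<open>With the common denominator \<open>2 ^ (p + q + 3)\<close> the four equations
    become linear in the same atoms.\<close>
  have h: "x / 2 ^ (p + q + 1) = 4 * (x / 2 ^ (p + q + 3))"
    "x / 2 ^ (p + q + 2) = 2 * (x / 2 ^ (p + q + 3))" for x :: real
    by (simp_all add: power_add)
  show ?thesis using 1 2 3 4 unfolding s h by linarith
qed

text \<open>The last two sums already give \<open>- binom_box_sum m n\<close> by
  \<open>binom_box_sum_eq\<close>. The remaining four terms add up to 0, which is a quarter of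
  \<open>binom_row_sum_shift\<close> at \<open>m - 2\<close> and \<open>n - 2\<close>.\<close>

lemma binom_box_sum_closed:
  assumes "m \<ge> 2" "n \<ge> 2"
  shows "- binom_box_sum m n = 1 / 4 + real ((m + n - 2) choose (m - 1)) / 2 ^ (m + n)
     - (1 / 2 ^ (m + n)) * (\<Sum>r<n. real ((m + n - 3 - r) choose (m - 2)) * 2 ^ r)
     - (1 / 2 ^ (m + n)) * (\<Sum>r<m. real ((m + n - 3 - r) choose (n - 2)) * 2 ^ r)
     - (real m / 2 ^ (m + n + 1)) * (\<Sum>r<n. real ((m + n - 1 - r) choose m) * 2 ^ r)
     - (real n / 2 ^ (m + n + 1)) * (\<Sum>r<m. real ((m + n - 1 - r) choose n) * 2 ^ r)"
proof -
  have lower: "(1 / 2 ^ (a + b)) * (\<Sum>r<b. real ((a + b - 3 - r) choose (a - 2)) * 2 ^ r)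
     = binom_row_sum (a - 2) b / 4" if "a \<ge> 2" for a b :: nat
  proof -
    obtain p where p: "a = 2 + p" using le_Suc_ex[OF \<open>2 \<le> a\<close>] by blast
    have *: "a + b - 3 - r = p + b - 1 - r" for r by (simp add: p)
    have "a - 2 = p" "(2::real) ^ (a + b) = 4 * 2 ^ (p + b)" by (simp_all add: p)
    then show ?thesis using binom_row_sum_reverse[of p b] unfolding * by simp
  qed
  have upper: "(real a / 2 ^ (a + b + 1)) * (\<Sum>r<b. real ((a + b - 1 - r) choose a) * 2 ^ r)
     = real a / 2 * binom_row_sum a b" for a b :: nat
    unfolding binom_row_sum_reverse[symmetric] by simp
  obtain p q where pq: "m = 2 + p" "n = 2 + q"
    using le_Suc_ex[OF assms(1)] le_Suc_ex[OF assms(2)] by blast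
  have shift: "binom_row_sum (m - 2) n + binom_row_sum (n - 2) m
     = 1 + 4 * (real ((m + n - 2) choose (m - 1)) / 2 ^ (m + n))"
  proof -
    have eqs: "m + n - 2 = p + q + 2" "m + n = p + q + 4" "m - 1 = p + 1" "m - 2 = p" "n - 2 = q"
      by (simp_all add: pq)
    have *: "4 * (x / 2 ^ (p + q + 4)) = x / 2 ^ (p + q + 2)" for x :: real
      by (simp add: power_add)
    show ?thesis
      unfolding eqs(1) unfolding eqs * using binom_row_sum_shift[of p q] by (simp only: pq add.commute[of 2])
  qed
  show ?thesis
    using shift lower[OF assms(1), of n] lower[OF assms(2), of m] upper[of m n] upper[of n m] binom_box_sum_eq[of m n]
    by (simp only: add.commute[of n m])
qed

section \<open>Circle and disk means of the logarithm\<close>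

text \<open>The mean value property of \<open>Ln (1 + a * z)\<close>, which vanishes at the centre.
  It is holomorphic on the closed disk because \<open>1 + a * z\<close> stays in the right
  half-plane.\<close>

lemma circle_mean_ln_cmod_one_plus:
  assumes "cmod a < 1"
  shows "((\<lambda>t. ln (cmod (1 + a * exp (2 * of_real pi * \<i> * of_real t)))) has_integral 0) {0..1}"
proof -
  define f where "f = (\<lambda>z. Ln (1 + a * z))"
  have nz: "1 + a * z \<notin> \<real>\<^sub>\<le>\<^sub>0" if "cmod z \<le> 1" for z
  proof -
    have "cmod (a * z) < 1"
      using assms that by (smt (verit, best) mult_left_le norm_ge_zero norm_mult)
    then have "Re (1 + a * z) > 0"
      using abs_Re_le_cmod[of "a * z"] by simp
    then show ?thesis by (auto simp: complex_nonpos_Reals_iff)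
  qed
  have "f holomorphic_on cball 0 1"
    unfolding f_def using nz by (intro holomorphic_intros) auto
  from Cauchy_integral_circlepath_simple[OF this, of 0]
  have "((\<lambda>u. f u / u) has_contour_integral 0) (circlepath 0 1)"
    by (simp add: f_def)
  \<comment> \<open>On the circle \<open>du\<close> is \<open>2 * pi * \<i> * u dt\<close>, so the
    factor \<open>1 / u\<close> cancels.\<close>
  then have "((\<lambda>x. f (exp (2 * of_real pi * \<i> * of_real x)) * (2 * of_real pi * \<i>)) has_integral 0) {0..1}"
    unfolding has_contour_integral_def
    by (rule has_integral_eq[rotated]) (simp only: vector_derivative_circlepath01 atLeastAtMost_iff, simp add: circlepath)
  from has_integral_divide[OF this, of "2 * of_real pi * \<i>"]
  have "((\<lambda>x. f (exp (2 * of_real pi * \<i> * of_real x))) has_integral 0) {0..1}"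
    by simp
  from has_integral_Re[OF this]
  have "((\<lambda>x. Re (f (exp (2 * of_real pi * \<i> * of_real x)))) has_integral 0) {0..1}"
    by simp
  then show ?thesis
  proof (rule has_integral_eq[rotated])
    fix t :: real
    have "1 + a * exp (2 * of_real pi * \<i> * of_real t) \<noteq> 0"
      using nz[of "exp (2 * of_real pi * \<i> * of_real t)"] by (auto simp: norm_exp_eq_Re)
    then show "Re (f (exp (2 * of_real pi * \<i> * of_real t))) =
       ln (cmod (1 + a * exp (2 * of_real pi * \<i> * of_real t)))"
      by (simp add: f_def)
  qed
qed

text \<open>Jensen's formula for a linear polynomial whose zero is off the unit circle. The
  coefficient of larger modulus is factored out, which reduces to the previous mean.\<close>

lemma circle_mean_ln_cmod:
  assumes "cmod a \<noteq> cmod b"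
  shows "((\<lambda>t. ln (cmod (a + b * exp (2 * of_real pi * \<i> * of_real t)))) has_integral
     ln (max (cmod a) (cmod b))) {0..1}"
proof -
  have main: "((\<lambda>t. ln (cmod (a + b * exp (2 * of_real pi * \<i> * of_real t)))) has_integral ln (cmod a)) {0..1}"
    if ab: "cmod b < cmod a" for a b :: complex
  proof -
    have a0: "a \<noteq> 0" using ab by auto
    have lt: "cmod (b / a) < 1" using ab a0 by (simp add: norm_divide divide_less_eq_1_pos)
    have "((\<lambda>t. ln (cmod a) + ln (cmod (1 + b / a * exp (2 * of_real pi * \<i> * of_real t)))) has_integral ln (cmod a) + 0) {0..1}"
      by (intro has_integral_add circle_mean_ln_cmod_one_plus[OF lt]) (use has_integral_const_real[of "ln (cmod a)" 0 1] in simp)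
    moreover have "ln (cmod a) + ln (cmod (1 + b / a * exp (2 * of_real pi * \<i> * of_real t)))
       = ln (cmod (a + b * exp (2 * of_real pi * \<i> * of_real t)))" for t :: real
    proof -
      have "cmod (b / a * exp (2 * of_real pi * \<i> * of_real t)) < 1"
        using lt by (simp only: norm_mult norm_exp_eq_Re) simp
      then have "1 + b / a * exp (2 * of_real pi * \<i> * of_real t) \<noteq> 0"
        by (metis add_eq_0_iff norm_minus_cancel norm_one order_less_irrefl)
      then have "ln (cmod a) + ln (cmod (1 + b / a * exp (2 * of_real pi * \<i> * of_real t)))
         = ln (cmod (a * (1 + b / a * exp (2 * of_real pi * \<i> * of_real t))))"
        using a0 by (simp only: norm_mult) (subst ln_mult, auto)
      then show ?thesis using a0 by (simp add: distrib_left)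
    qed
    ultimately show ?thesis by simp
  qed
  show ?thesis
  proof (cases "cmod b < cmod a")
    case True
    with main[OF this] show ?thesis by (simp add: max_def)
  next
    case False
    then have lt: "cmod (cnj a) < cmod (cnj b)" using assms by simp
    \<comment> \<open>Conjugating and then multiplying by the unimodular exponential preserves the
      modulus and exchanges the roles of \<open>a\<close> and \<open>b\<close>.\<close>
    have "cmod (cnj b + cnj a * exp (2 * of_real pi * \<i> * of_real t))
       = cmod (a + b * exp (2 * of_real pi * \<i> * of_real t))" for t :: real
    proof -
      let ?e = "exp (2 * of_real pi * \<i> * of_real t)"
      have e: "cnj ?e * ?e = 1"
        using complex_norm_square[of ?e]
        by (simp only: norm_exp_eq_Re mult.commute[of ?e]) simp
      have "cmod (a + b * ?e) = cmod (cnj (a + b * ?e))" by (simp only: complex_mod_cnj)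
      also have "\<dots> = cmod (cnj (a + b * ?e) * ?e)" by (simp only: norm_mult norm_exp_eq_Re) simp
      also have "cnj (a + b * ?e) * ?e = cnj b + cnj a * ?e"
        using e by (simp add: algebra_simps)
      finally show ?thesis by simp
    qed
    with main[OF lt] False show ?thesis by (simp add: max_def)
  qed
qed

section \<open>Rotation invariance of area and averaging over circles\<close>

lemma nn_integral_lborel_translate:
  fixes f :: "'a::euclidean_space \<Rightarrow> ennreal"
  assumes [measurable]: "f \<in> borel_measurable borel"
  shows "(\<integral>\<^sup>+x. f (c + x) \<partial>lborel) = (\<integral>\<^sup>+x. f x \<partial>lborel)"
proof -
  have "(\<integral>\<^sup>+x. f x \<partial>lborel) = (\<integral>\<^sup>+x. f x \<partial>distr lborel borel ((+) c))"
    by (simp add: lborel_distr_plus)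
  also have "\<dots> = (\<integral>\<^sup>+x. f (c + x) \<partial>lborel)"
    by (subst nn_integral_distr) auto
  finally show ?thesis ..
qed

text \<open>Uniqueness of Haar measure: evaluating
  \<open>\<integral>\<integral> indicator A (c x) indicator B (y - c x) dx dy\<close> in both orders shows that the translation
  invariant rotated measure is proportional to \<open>lborel\<close>, and the two agree on the disk \<open>B\<close>.\<close>

lemma lborel_distr_rotation:
  fixes c :: complex
  assumes c: "cmod c = 1"
  shows "distr lborel borel ((*) c) = lborel"
proof (rule measure_eqI)
  fix A assume "A \<in> sets (distr lborel borel ((*) c))"
  then have A[measurable]: "A \<in> sets borel" by simp
  define B where "B = ball (0::complex) 1"
  have B[measurable]: "B \<in> sets borel" by (simp add: B_def)
  have B_fin: "emeasure lborel B \<noteq> 0" "emeasure lborel B \<noteq> \<infinity>"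
    by (auto simp: B_def emeasure_ball unit_ball_vol_2)
  have c0: "c \<noteq> 0" using c by auto
  have "emeasure (distr lborel borel ((*) c)) A * emeasure lborel B
      = (\<integral>\<^sup>+x. indicator A (c * x) * emeasure lborel B \<partial>lborel)"
  proof -
    have "emeasure (distr lborel borel ((*) c)) A = (\<integral>\<^sup>+x. indicator A x \<partial>distr lborel borel ((*) c))"
      by simp
    also have "\<dots> = (\<integral>\<^sup>+x. indicator A (c * x) \<partial>lborel)"
      by (rule nn_integral_distr) simp_all
    finally show ?thesis by (subst nn_integral_multc) auto
  qed
  also have "\<dots> = (\<integral>\<^sup>+x. \<integral>\<^sup>+y. indicator A (c * x) * indicator B (- (c * x) + y) \<partial>lborel \<partial>lborel)"
  proof (rule nn_integral_cong)
    fix x :: complex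
    have "(\<integral>\<^sup>+y. indicator B (- (c * x) + y) \<partial>lborel) = emeasure lborel B"
      using nn_integral_lborel_translate[of "indicator B" "- (c * x)"] by simp
    then show "indicator A (c * x) * emeasure lborel B
       = (\<integral>\<^sup>+y. indicator A (c * x) * indicator B (- (c * x) + y) \<partial>lborel)"
      by (subst nn_integral_cmult) simp_all
  qed
  also have "\<dots> = (\<integral>\<^sup>+y. \<integral>\<^sup>+x. indicator A (c * x) * indicator B (- (c * x) + y) \<partial>lborel \<partial>lborel)"
    by (rule lborel_pair.Fubini') measurable
  \<comment> \<open>Translating \<open>x\<close> by \<open>y / c\<close> moves \<open>y\<close> from
    the argument of \<open>B\<close> into that of \<open>A\<close>.\<close>
  also have "\<dots> = (\<integral>\<^sup>+y. \<integral>\<^sup>+x. indicator A (c * x + y) * indicator B (- (c * x)) \<partial>lborel \<partial>lborel)"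
  proof (rule nn_integral_cong)
    fix y :: complex
    show "(\<integral>\<^sup>+x. indicator A (c * x) * indicator B (- (c * x) + y) \<partial>lborel)
        = (\<integral>\<^sup>+x. indicator A (c * x + y) * indicator B (- (c * x)) \<partial>(lborel::complex measure))"
      by (subst nn_integral_lborel_translate[of _ "y / c", symmetric])
         (use c0 in \<open>auto simp: distrib_left add.commute\<close>)
  qed
  also have "\<dots> = (\<integral>\<^sup>+x. \<integral>\<^sup>+y. indicator A (c * x + y) * indicator B (- (c * x)) \<partial>lborel \<partial>lborel)"
    by (rule lborel_pair.Fubini'[symmetric]) measurable
  also have "\<dots> = (\<integral>\<^sup>+x. emeasure lborel A * indicator B x \<partial>lborel)"
  proof (rule nn_integral_cong)
    fix x :: complex
    \<comment> \<open>The disk \<open>B\<close> is invariant under multiplication by the unimodular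
      number \<open>- c\<close>.\<close>
    have "indicator B (- (c * x)) = (indicator B x :: ennreal)"
      by (simp add: B_def indicator_def norm_mult c)
    then show "(\<integral>\<^sup>+y. indicator A (c * x + y) * indicator B (- (c * x)) \<partial>lborel) = emeasure lborel A * indicator B x"
      by (subst nn_integral_multc) (auto simp: nn_integral_lborel_translate)
  qed
  also have "\<dots> = emeasure lborel A * emeasure lborel B"
    by (subst nn_integral_cmult) auto
  finally show "emeasure (distr lborel borel ((*) c)) A = emeasure lborel A"
    using B_fin by (simp add: ennreal_mult_cancel_left mult.commute[of _ "emeasure lborel B"])
qed simp

lemma space_disk_measure[simp]: "space disk_measure = cball 0 1"
  by (simp add: disk_measure_def space_restrict_space)

lemma ident_measurable_disk_measure[measurable]: "(\<lambda>x. x) \<in> measurable disk_measure borel"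
  by (simp add: disk_measure_def measurable_restrict_space1)

lemma emeasure_disk_measure_space: "emeasure disk_measure (cball 0 1) = ennreal pi"
  by (simp add: disk_measure_def emeasure_restrict_space emeasure_cball unit_ball_vol_2)

lemma nn_integral_disk_measure:
  "(\<integral>\<^sup>+x. f x \<partial>disk_measure) = (\<integral>\<^sup>+x. f x * indicator (cball 0 1) x \<partial>lborel)"
  by (simp add: disk_measure_def nn_integral_restrict_space)

interpretation disk_measure: finite_measure disk_measure
  by standard (simp add: emeasure_disk_measure_space)

lemma nn_integral_disk_rotation:
  assumes [measurable]: "f \<in> borel_measurable borel" and c: "cmod c = 1"
  shows "(\<integral>\<^sup>+x. f (c * x) \<partial>disk_measure) = (\<integral>\<^sup>+x. f x \<partial>disk_measure)"
proof -
  have [measurable]: "cball (0::complex) 1 \<in> sets borel" by simp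
  have "(\<integral>\<^sup>+x. f x \<partial>disk_measure) = (\<integral>\<^sup>+x. f x * indicator (cball 0 1) x \<partial>distr lborel borel ((*) c))"
    by (simp add: nn_integral_disk_measure lborel_distr_rotation[OF c])
  also have "\<dots> = (\<integral>\<^sup>+x. f (c * x) * indicator (cball 0 1) (c * x) \<partial>lborel)"
    by (rule nn_integral_distr) simp_all
  also have "\<dots> = (\<integral>\<^sup>+x. f (c * x) \<partial>disk_measure)"
    unfolding nn_integral_disk_measure
    by (intro nn_integral_cong) (simp add: indicator_def norm_mult c)
  finally show ?thesis ..
qed

text \<open>Every rotation leaves the integral unchanged, so it equals its average over all angles;
  Tonelli's theorem moves that average inside.\<close>

lemma nn_integral_disk_average:
  assumes [measurable]: "f \<in> borel_measurable borel"
  shows "(\<integral>\<^sup>+x. f x \<partial>disk_measure)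
    = (\<integral>\<^sup>+x. \<integral>\<^sup>+t. f (exp (2 * of_real pi * \<i> * of_real t) * x) * indicator {0..1} t \<partial>lborel \<partial>disk_measure)"
proof -
  interpret P: pair_sigma_finite disk_measure "lborel :: real measure"
    by standard
  have "(\<integral>\<^sup>+x. \<integral>\<^sup>+t. f (exp (2 * of_real pi * \<i> * of_real t) * x) * indicator {0..1} t \<partial>lborel \<partial>disk_measure)
    = (\<integral>\<^sup>+t. \<integral>\<^sup>+x. f (exp (2 * of_real pi * \<i> * of_real t) * x) * indicator {0..1} t \<partial>disk_measure \<partial>lborel)"
    by (rule P.Fubini'[symmetric]) measurable
  also have "\<dots> = (\<integral>\<^sup>+t. (\<integral>\<^sup>+x. f x \<partial>disk_measure) * indicator {0..1} (t::real) \<partial>lborel)"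
  proof (rule nn_integral_cong)
    fix t :: real
    have "cmod (exp (2 * of_real pi * \<i> * of_real t)) = 1"
      by (simp only: norm_exp_eq_Re) simp
    from nn_integral_disk_rotation[OF _ this, of f]
    show "(\<integral>\<^sup>+x. f (exp (2 * of_real pi * \<i> * of_real t) * x) * indicator {0..1} t \<partial>disk_measure)
      = (\<integral>\<^sup>+x. f x \<partial>disk_measure) * indicator {0..1} (t::real)"
      by (subst nn_integral_multc) auto
  qed
  also have "\<dots> = (\<integral>\<^sup>+x. f x \<partial>disk_measure)"
    by (subst nn_integral_cmult) auto
  finally show ?thesis ..
qed

text \<open>Circles have area zero. This discards the radius at which
  \<open>circle_mean_ln_cmod\<close> does not apply and, for \<open>r = 0\<close>, the
  origin.\<close>

lemma AE_disk_cmod_neq: "AE y in disk_measure. cmod y \<noteq> r"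
proof -
  have "sphere (0::complex) r \<in> null_sets lborel"
    using negligible_sphere[of "0::complex" r]
    by (simp add: negligible_iff_null_sets null_sets_completion_iff)
  then have "AE y in lborel. y \<notin> sphere (0::complex) r" by (rule AE_not_in)
  then show ?thesis
    unfolding disk_measure_def by (subst AE_restrict_space_iff) (auto elim!: AE_mp)
qed

text \<open>Subtracting from \<open>ln 2\<close> keeps everything nonnegative, so that Tonelli's theorem needs no integrability
  hypothesis.\<close>

lemma nn_integral_disk_ln:
  assumes a: "cmod a \<le> 1" and b: "cmod b \<le> 1"
  shows "(\<integral>\<^sup>+y. ennreal (ln 2 - ln (cmod (a + b * y))) \<partial>disk_measure)
    = (\<integral>\<^sup>+y. ennreal (ln 2 - ln (max (cmod a) (cmod (b * y)))) \<partial>disk_measure)"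
proof (cases "b = 0")
  case False
  have "(\<integral>\<^sup>+y. ennreal (ln 2 - ln (cmod (a + b * y))) \<partial>disk_measure)
    = (\<integral>\<^sup>+y. \<integral>\<^sup>+t. ennreal (ln 2 - ln (cmod (a + b * (exp (2 * of_real pi * \<i> * of_real t) * y))))
        * indicator {0..1} t \<partial>lborel \<partial>disk_measure)"
    by (rule nn_integral_disk_average) measurable
  also have "\<dots> = (\<integral>\<^sup>+y. ennreal (ln 2 - ln (max (cmod a) (cmod (b * y)))) \<partial>disk_measure)"
  proof (rule nn_integral_cong_AE)
    \<comment> \<open>The excluded radius is the one at which
      \<open>cmod a = cmod (b * y)\<close>.\<close>
    from AE_disk_cmod_neq[of "cmod a / cmod b"] AE_space
    show "AE y in disk_measure.
      (\<integral>\<^sup>+t. ennreal (ln 2 - ln (cmod (a + b * (exp (2 * of_real pi * \<i> * of_real t) * y)))) * indicator {0..1} t \<partial>lborel)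
      = ennreal (ln 2 - ln (max (cmod a) (cmod (b * y))))"
    proof eventually_elim
      case (elim y)
      then have ne: "cmod a \<noteq> cmod (b * y)" and y: "cmod y \<le> 1"
        using False by (auto simp: norm_mult field_simps)
      have by1: "cmod (b * y) \<le> 1" using b y by (simp add: norm_mult mult_le_one)
      have *: "((\<lambda>t. ln 2 - ln (cmod (a + b * (exp (2 * of_real pi * \<i> * of_real t) * y))))
         has_integral ln 2 - ln (max (cmod a) (cmod (b * y)))) {0..1}"
        using has_integral_diff[OF has_integral_const_real[of "ln 2" 0 1] circle_mean_ln_cmod[OF ne]]
        by (simp add: ac_simps)
      have nonneg: "ln 2 - ln (cmod (a + b * (exp (2 * of_real pi * \<i> * of_real t) * y))) \<ge> 0" for t :: real
      proof -
        have e: "cmod (exp (2 * of_real pi * \<i> * of_real t)) = 1"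
          by (simp only: norm_exp_eq_Re) simp
        have "cmod (a + b * (exp (2 * of_real pi * \<i> * of_real t) * y)) \<le> cmod a + cmod (b * y)"
          using norm_triangle_ineq[of a "b * (exp (2 * of_real pi * \<i> * of_real t) * y)"]
          by (simp only: norm_mult e mult_1)
        then have le: "cmod (a + b * (exp (2 * of_real pi * \<i> * of_real t) * y)) \<le> 2"
          using a by1 by linarith
        \<comment> \<open>At a zero of the argument the convention \<open>ln 0 = 0\<close> gives the
          value \<open>ln 2\<close>, which is still nonnegative.\<close>
        show ?thesis
          using le by (cases "a + b * (exp (2 * of_real pi * \<i> * of_real t) * y) = 0") auto
      qed
      from nn_integral_has_integral_lebesgue[OF nonneg *]
      have "integral\<^sup>N lborel (\<lambda>x. indicator {0..1} x *
        (ln 2 - ln (cmod (a + b * (exp (2 * of_real pi * \<i> * of_real x) * y))))) = 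
        ennreal (ln 2 - ln (max (cmod a) (cmod (b * y))))"
        by simp
      then show ?case
        by (smt (verit) nn_integral_cong indicator_mult_ennreal mult.commute)
    qed
  qed
  finally show ?thesis .
qed simp

section \<open>Gamma distributed moduli\<close>

text \<open>The layer cake formula: the positive part of the minimum is the length of the set of
  \<open>t \<ge> 0\<close> lying below both variables. After Tonelli's theorem, independence factors
  the probability.\<close>

lemma (in prob_space) nn_integral_min_indep:
  fixes X Y :: "'a \<Rightarrow> real"
  assumes ind: "indep_var borel X borel Y"
  shows "(\<integral>\<^sup>+\<omega>. ennreal (min (X \<omega>) (Y \<omega>)) \<partial>M)
     = (\<integral>\<^sup>+t. ennreal (\<P>(\<omega> in M. t < X \<omega>) * \<P>(\<omega> in M. t < Y \<omega>)) * indicator {0..} t \<partial>lborel)"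
proof -
  note [measurable] = indep_var_rv1[OF ind] indep_var_rv2[OF ind]
  interpret P: pair_sigma_finite M "lborel :: real measure"
    by standard
  have "(\<integral>\<^sup>+\<omega>. ennreal (min (X \<omega>) (Y \<omega>)) \<partial>M)
      = (\<integral>\<^sup>+\<omega>. \<integral>\<^sup>+t. indicator {\<omega>\<in>space M. t < X \<omega> \<and> t < Y \<omega>} \<omega> * indicator {0..} t \<partial>lborel \<partial>M)"
  proof (rule nn_integral_cong)
    fix \<omega> assume \<omega>: "\<omega> \<in> space M"
    \<comment> \<open>For negative \<open>u\<close> both sides are 0, since \<open>ennreal\<close>
      truncates and the interval is empty.\<close>
    have "ennreal u = emeasure lborel {0..<u}" for u :: real
      by (cases "u \<ge> 0") (simp_all add: ennreal_neg)
    then have "ennreal (min (X \<omega>) (Y \<omega>)) = emeasure lborel {0..<min (X \<omega>) (Y \<omega>)}" .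
    also have "\<dots> = (\<integral>\<^sup>+t. indicator {0..<min (X \<omega>) (Y \<omega>)} t \<partial>lborel)" by simp
    also have "\<dots> = (\<integral>\<^sup>+t. indicator {\<omega>\<in>space M. t < X \<omega> \<and> t < Y \<omega>} \<omega> * indicator {0..} t \<partial>lborel)"
      using \<omega> by (intro nn_integral_cong) (auto simp: indicator_def)
    finally show "ennreal (min (X \<omega>) (Y \<omega>)) = \<dots>" .
  qed
  also have "\<dots> = (\<integral>\<^sup>+t. \<integral>\<^sup>+\<omega>. indicator {\<omega>\<in>space M. t < X \<omega> \<and> t < Y \<omega>} \<omega> * indicator {0..} t \<partial>M \<partial>lborel)"
    by (rule P.Fubini'[symmetric]) measurable
  also have "\<dots> = (\<integral>\<^sup>+t. ennreal (\<P>(\<omega> in M. t < X \<omega>) * \<P>(\<omega> in M. t < Y \<omega>)) * indicator {0..} t \<partial>lborel)"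
  proof (rule nn_integral_cong)
    fix t :: real
    have "prob {\<omega>\<in>space M. t < X \<omega> \<and> t < Y \<omega>}
       = prob ((\<lambda>\<omega>. (X \<omega>, Y \<omega>)) -` ({t<..} \<times> {t<..}) \<inter> space M)"
      by (intro arg_cong[where f = prob]) auto
    also have "\<dots> = prob (X -` {t<..} \<inter> space M) * prob (Y -` {t<..} \<inter> space M)"
      by (rule indep_varD[OF ind]) auto
    also have "\<dots> = \<P>(\<omega> in M. t < X \<omega>) * \<P>(\<omega> in M. t < Y \<omega>)"
      by (intro arg_cong2[where f = "(*)"] arg_cong[where f = prob]) auto
    finally show "(\<integral>\<^sup>+\<omega>. indicator {\<omega>\<in>space M. t < X \<omega> \<and> t < Y \<omega>} \<omega> * indicator {0..} t \<partial>M)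
       = ennreal (\<P>(\<omega> in M. t < X \<omega>) * \<P>(\<omega> in M. t < Y \<omega>)) * indicator {0..} t"
      by (subst nn_integral_multc) (auto simp: emeasure_eq_measure)
  qed
  finally show ?thesis .
qed

lemma nn_integral_erlang_density_UNIV:
  "0 < l \<Longrightarrow> (\<integral>\<^sup>+t. ennreal (erlang_density k l t) \<partial>lborel) = 1"
  using nn_integral_erlang_ith_moment[of l k 0] by simp

text \<open>The tail of a Gamma variable of shape \<open>k + 1\<close> and rate 2 is a sum of \<open>k + 1\<close> terms, and the product of two
  such terms is a multiple of a Gamma density of rate 4.\<close>

lemma nn_integral_min_erlang:
  fixes X Y :: "'a \<Rightarrow> real"
  assumes "prob_space M"
    and ind: "prob_space.indep_var M borel X borel Y"
    and X: "distributed M lborel X (erlang_density m 2)"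
    and Y: "distributed M lborel Y (erlang_density n 2)"
  shows "(\<integral>\<^sup>+\<omega>. ennreal (min (X \<omega>) (Y \<omega>)) \<partial>M) = ennreal (binom_box_sum (Suc m) (Suc n))"
proof -
  interpret prob_space M by fact
  have gt: "\<P>(\<omega> in M. t < Z \<omega>) = (\<Sum>i<Suc k. (2 * t) ^ i * exp (- 2 * t) / fact i)"
    if "distributed M lborel Z (erlang_density k 2)" "t \<ge> 0" for Z k t
    using erlang_distributed_gt[OF that(1) _ that(2)] that(2)
    by (simp add: erlang_CDF_def lessThan_Suc_atMost)
  define c where "c = (\<lambda>i j. real ((i + j) choose i) / 2 ^ (i + j + 2))"
  have "(\<integral>\<^sup>+\<omega>. ennreal (min (X \<omega>) (Y \<omega>)) \<partial>M)
     = (\<integral>\<^sup>+t. (\<Sum>i<Suc m. \<Sum>j<Suc n. ennreal (c i j) * ennreal (erlang_density (i + j) 4 t)) \<partial>lborel)"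
    unfolding nn_integral_min_indep[OF ind]
  proof (rule nn_integral_cong)
    fix t :: real
    show "ennreal (\<P>(\<omega> in M. t < X \<omega>) * \<P>(\<omega> in M. t < Y \<omega>)) * indicator {0..} t
       = (\<Sum>i<Suc m. \<Sum>j<Suc n. ennreal (c i j) * ennreal (erlang_density (i + j) 4 t))"
    proof (cases "t \<ge> 0")
      case False
      then show ?thesis by (simp add: erlang_density_def)
    next
      case True
      have *: "(2 * t) ^ i * exp (- 2 * t) / fact i * ((2 * t) ^ j * exp (- 2 * t) / fact j)
         = c i j * erlang_density (i + j) 4 t" for i j
      proof -
        have "real ((i + j) choose i) = fact (i + j) / (fact i * fact j)"
          by (simp add: binomial_fact)
        \<comment> \<open>The factor \<open>2 ^ (i + j)\<close> comes from the two powers of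
          \<open>2 * t\<close>; the other one is the denominator of \<open>c i j\<close>.\<close>
        moreover have "(4::real) ^ Suc (i + j) = 2 ^ (i + j) * 2 ^ (i + j + 2)"
        proof -
          have "(4::real) ^ k = 2 ^ k * 2 ^ k" for k by (simp add: power_mult_distrib[symmetric])
          then show ?thesis by (simp add: power_add)
        qed
        moreover have "exp (- 4 * t) = exp (- 2 * t) * exp (- 2 * t)"
          by (simp add: exp_add[symmetric])
        ultimately show ?thesis
          using True by (simp add: c_def erlang_density_def power_mult_distrib power_add)
      qed
      have nn: "0 \<le> c i j * erlang_density (i + j) 4 t" for i j
        by (simp add: c_def)
      have "\<P>(\<omega> in M. t < X \<omega>) * \<P>(\<omega> in M. t < Y \<omega>) = (\<Sum>i<Suc m. \<Sum>j<Suc n. c i j * erlang_density (i + j) 4 t)"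
        unfolding gt[OF X True] gt[OF Y True] sum_product * ..
      moreover have "ennreal (\<Sum>i<Suc m. \<Sum>j<Suc n. c i j * erlang_density (i + j) 4 t)
         = (\<Sum>i<Suc m. \<Sum>j<Suc n. ennreal (c i j) * ennreal (erlang_density (i + j) 4 t))"
        using nn by (simp add: ennreal_mult''[symmetric] sum_nonneg del: sum.lessThan_Suc)
      ultimately show ?thesis using True by simp
    qed
  qed
  also have "\<dots> = (\<Sum>i<Suc m. \<Sum>j<Suc n. ennreal (c i j))"
    by (simp add: nn_integral_sum nn_integral_cmult nn_integral_erlang_density_UNIV del: sum.lessThan_Suc)
  also have "\<dots> = ennreal (binom_box_sum (Suc m) (Suc n))"
    by (simp add: binom_box_sum_def c_def sum_nonneg del: sum.lessThan_Suc)
  finally show ?thesis .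
qed

section \<open>The uniform distribution on the disk\<close>

definition unit_disk :: "complex measure" where
  "unit_disk = scale_measure (ennreal (1 / pi)) disk_measure"

lemma sets_unit_disk[measurable_cong, simp]: "sets unit_disk = sets disk_measure"
  by (simp add: unit_disk_def)

lemma space_unit_disk[simp]: "space unit_disk = cball 0 1"
  by (simp add: unit_disk_def space_scale_measure)

interpretation unit_disk: prob_space unit_disk
  by standard (simp add: unit_disk_def space_scale_measure emeasure_disk_measure_space ennreal_mult''[symmetric])

text \<open>The origin must be discarded because \<open>ln 0 = 0\<close> there stands in for minus
  infinity. Scaling the measure keeps null sets null.\<close>

lemma AE_unit_disk_neq_0: "AE y in unit_disk. y \<noteq> 0"
proof -
  obtain N where "N \<in> null_sets disk_measure" "{y \<in> space disk_measure. \<not> cmod y \<noteq> 0} \<subseteq> N"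
    using AE_disk_cmod_neq[of 0] unfolding eventually_ae_filter by blast
  moreover from this have "N \<in> null_sets unit_disk"
    by (simp add: null_sets_def unit_disk_def)
  ultimately show ?thesis
    unfolding eventually_ae_filter by auto
qed

text \<open>The disk of radius \<open>exp (- a)\<close> has the fraction
  \<open>exp (- 2 * a)\<close> of the area, which is the exponential tail of rate 2.\<close>

lemma distributed_neg_ln_cmod:
  "distributed unit_disk lborel (\<lambda>x. - ln (cmod x)) (exponential_density 2)"
proof (rule exponential_distributedI)
  show meas[measurable]: "(\<lambda>x. - ln (cmod x)) \<in> borel_measurable unit_disk" by measurable
  fix a :: real assume a: "0 \<le> a"
  have sub: "ball 0 (exp (- a)) \<subseteq> cball (0::complex) 1"
    using a by (intro order.trans[OF ball_subset_cball] subset_cball) simp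
  have "emeasure disk_measure (ball 0 (exp (- a))) = ennreal (pi * exp (- a) ^ 2)"
    using sub by (simp add: disk_measure_def emeasure_restrict_space emeasure_ball unit_ball_vol_2)
  then have "emeasure unit_disk (ball 0 (exp (- a))) = ennreal (exp (- a) ^ 2)"
    by (simp add: unit_disk_def ennreal_mult''[symmetric])
  then have ball: "unit_disk.prob (ball 0 (exp (- a))) = exp (- a * 2)"
    by (simp add: measure_def exp_double[symmetric] mult.commute)
  have ball_sets[measurable]: "ball 0 (exp (- a)) \<in> sets unit_disk"
    using sub by (auto simp: disk_measure_def sets_restrict_space intro!: image_eqI[of _ _ "ball 0 (exp (- a))"])
  \<comment> \<open>The two sets differ exactly at the origin, which belongs to the left one by the
    convention \<open>ln 0 = 0\<close>.\<close>
  have "emeasure unit_disk {x \<in> space unit_disk. - ln (cmod x) \<le> a}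
     = emeasure unit_disk (space unit_disk - ball 0 (exp (- a)))"
  proof (rule emeasure_eq_AE)
    show "AE x in unit_disk. (x \<in> {x \<in> space unit_disk. - ln (cmod x) \<le> a})
       = (x \<in> space unit_disk - ball 0 (exp (- a)))"
      using AE_unit_disk_neq_0
    proof eventually_elim
      case (elim x)
      have "- ln (cmod x) \<le> a \<longleftrightarrow> exp (- a) \<le> cmod x"
        using elim by (subst ln_ge_iff[symmetric]) auto
      then show ?case by auto
    qed
  next
    show "{x \<in> space unit_disk. - ln (cmod x) \<le> a} \<in> sets unit_disk"
      by (rule borel_measurable_le[OF meas]) simp
    show "space unit_disk - ball 0 (exp (- a)) \<in> sets unit_disk"
      by (intro sets.Diff sets.top) measurable
  qed
  also have "\<dots> = ennreal (1 - exp (- a * 2))"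
    using unit_disk.prob_compl[OF ball_sets] by (simp add: unit_disk.emeasure_eq_measure ball del: space_unit_disk)
  finally show "emeasure unit_disk {x \<in> space unit_disk. - ln (cmod x) \<le> a} = 1 - ennreal (exp (- a * 2))"
    by (simp add: ennreal_minus ennreal_1[symmetric] del: ennreal_1)
qed simp

section \<open>Product measures and independent coordinates\<close>

text \<open>A finite product measure is determined by its values on boxes, where each coordinate
  contributes one factor \<open>1 / pi\<close>.\<close>

lemma PiM_disk_measure_eq:
  assumes "finite I"
  shows "PiM I (\<lambda>_. unit_disk) = scale_measure (ennreal ((1 / pi) ^ card I)) (PiM I (\<lambda>_. disk_measure))"
proof -
  interpret U: product_sigma_finite "\<lambda>_::'a. unit_disk" by standard
  interpret D: product_sigma_finite "\<lambda>_::'a. disk_measure" by standard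
  show ?thesis
  proof (rule U.PiM_eqI[symmetric])
    show "sets (scale_measure (ennreal ((1 / pi) ^ card I)) (PiM I (\<lambda>_. disk_measure))) = sets (PiM I (\<lambda>_. unit_disk))"
      by (simp cong: sets_PiM_cong)
    fix A :: "'a \<Rightarrow> complex set" assume "\<And>i. i \<in> I \<Longrightarrow> A i \<in> sets unit_disk"
    then show "emeasure (scale_measure (ennreal ((1 / pi) ^ card I)) (PiM I (\<lambda>_. disk_measure))) (Pi\<^sub>E I A)
       = (\<Prod>i\<in>I. emeasure unit_disk (A i))"
      using assms by (simp add: D.emeasure_PiM unit_disk_def prod.distrib ennreal_power)
  qed (rule assms)
qed

lemma measurable_PiM_disk_component:
  "i \<in> I \<Longrightarrow> (\<lambda>x. x i) \<in> borel_measurable (PiM I (\<lambda>_. disk_measure))"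
  using measurable_compose[OF measurable_component_singleton[of i I "\<lambda>_. disk_measure"] ident_measurable_disk_measure]
  by simp

lemma measurable_prods_disk[measurable]:
  fixes m n :: nat
  shows "(\<lambda>x. \<Prod>i<m. x i) \<in> borel_measurable (PiM {..<m + n} (\<lambda>_. disk_measure))"
  "(\<lambda>x. \<Prod>j<n. x (m + j)) \<in> borel_measurable (PiM {..<m + n} (\<lambda>_. disk_measure))"
  by (auto intro!: borel_measurable_prod measurable_PiM_disk_component)

lemma cmod_prod_le_1:
  assumes "x \<in> space (PiM {..<k} (\<lambda>_. disk_measure))" "\<And>i. i \<in> A \<Longrightarrow> g i < k"
  shows "cmod (\<Prod>i\<in>A. x (g i)) \<le> 1"
proof -
  have "cmod (x (g i)) \<le> 1" if "i \<in> A" for i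
    using assms(1) assms(2)[OF that] by (auto simp: space_PiM PiE_iff)
  then show ?thesis by (auto simp: prod_norm[symmetric] intro: prod_le_1)
qed

text \<open>The coordinate \<open>m + n\<close> is integrated first. The others are then fixed, and
  \<open>nn_integral_disk_ln\<close> applies with \<open>a\<close> the first product and
  \<open>b\<close> the rest of the second.\<close>

lemma nn_integral_prods_max:
  "(\<integral>\<^sup>+x. ennreal (ln 2 - ln (cmod ((\<Prod>i<m. x i) + (\<Prod>j<Suc n. x (m + j)))))
      \<partial>PiM {..<m + Suc n} (\<lambda>_. disk_measure))
   = (\<integral>\<^sup>+x. ennreal (ln 2 - ln (max (cmod (\<Prod>i<m. x i)) (cmod (\<Prod>j<Suc n. x (m + j)))))
      \<partial>PiM {..<m + Suc n} (\<lambda>_. disk_measure))"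
proof -
  interpret D: product_sigma_finite "\<lambda>_::nat. disk_measure" by standard
  have ins: "{..<m + Suc n} = insert (m + n) {..<m + n}" by auto
  have m1: "(\<lambda>x. ennreal (ln 2 - ln (cmod ((\<Prod>i<m. x i) + (\<Prod>j<Suc n. x (m + j))))))
     \<in> borel_measurable (PiM (insert (m + n) {..<m + n}) (\<lambda>_. disk_measure))"
    unfolding ins[symmetric] by measurable
  have m2: "(\<lambda>x. ennreal (ln 2 - ln (max (cmod (\<Prod>i<m. x i)) (cmod (\<Prod>j<Suc n. x (m + j))))))
     \<in> borel_measurable (PiM (insert (m + n) {..<m + n}) (\<lambda>_. disk_measure))"
    unfolding ins[symmetric] by measurable
  have upd: "(\<Prod>i<m. (x(m + n := y)) i) = (\<Prod>i<m. x i)"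
    "(\<Prod>j<Suc n. (x(m + n := y)) (m + j)) = (\<Prod>j<n. x (m + j)) * y" for x :: "nat \<Rightarrow> complex" and y
    by (auto intro!: prod.cong)
  show ?thesis
    unfolding ins
    unfolding D.product_nn_integral_insert[OF finite_lessThan _ m1, simplified lessThan_iff, OF less_irrefl]
      D.product_nn_integral_insert[OF finite_lessThan _ m2, simplified lessThan_iff, OF less_irrefl] upd
    by (intro nn_integral_cong nn_integral_disk_ln cmod_prod_le_1[where k = "m + n"]) auto
qed

lemma distributed_neg_ln_coord:
  assumes "i \<in> I"
  shows "distributed (PiM I (\<lambda>_. unit_disk)) lborel (\<lambda>x. - ln (cmod (x i))) (exponential_density 2)"
proof -
  have meas: "(\<lambda>x. - ln (cmod x)) \<in> measurable unit_disk lborel"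
    using distributed_neg_ln_cmod by (rule distributed_measurable)
  have comp: "(\<lambda>x. x i) \<in> measurable (PiM I (\<lambda>_. unit_disk)) unit_disk"
    using assms by (rule measurable_component_singleton)
  have "distr (PiM I (\<lambda>_. unit_disk)) lborel (\<lambda>x. - ln (cmod (x i)))
     = distr (distr (PiM I (\<lambda>_. unit_disk)) unit_disk (\<lambda>x. x i)) lborel (\<lambda>x. - ln (cmod x))"
    by (simp add: distr_distr[OF meas comp] comp_def)
  also have "distr (PiM I (\<lambda>_. unit_disk)) unit_disk (\<lambda>x. x i) = unit_disk"
    by (rule distr_PiM_component) (use assms unit_disk.prob_space_axioms in auto)
  also have "distr unit_disk lborel (\<lambda>x. - ln (cmod x)) = density lborel (exponential_density 2)"
    using distributed_neg_ln_cmod by (rule distributed_distr_eq_density)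
  finally show ?thesis
    using measurable_compose[OF comp meas] by (simp add: distributed_def)
qed

text \<open>Independence means that the joint law is the product of the marginals, and the
  coordinatewise image of a product measure is the product of the image measures.\<close>

lemma indep_vars_PiM_compose:
  assumes "finite I" "I \<noteq> {}" "prob_space M" and f: "f \<in> measurable M N"
  shows "prob_space.indep_vars (PiM I (\<lambda>_. M)) (\<lambda>_. N) (\<lambda>i x. f (x i)) I"
proof -
  interpret M: prob_space M by fact
  interpret P: prob_space "PiM I (\<lambda>_. M)" by (rule prob_space_PiM) (rule assms)
  have coord: "distr (PiM I (\<lambda>_. M)) N (\<lambda>x. f (x i)) = distr M N f" if "i \<in> I" for i
  proof -
    have "distr (PiM I (\<lambda>_. M)) N (\<lambda>x. f (x i)) = distr (distr (PiM I (\<lambda>_. M)) M (\<lambda>x. x i)) N f"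
      by (subst distr_distr[OF f measurable_component_singleton[OF that]]) (simp add: comp_def)
    also have "distr (PiM I (\<lambda>_. M)) M (\<lambda>x. x i) = M"
      by (rule distr_PiM_component) (use assms that in auto)
    finally show ?thesis .
  qed
  \<comment> \<open>The target \<open>N\<close> is replaced by the probability space
    \<open>distr M N f\<close>, which has the same measurable sets.\<close>
  have "distr (PiM I (\<lambda>_. M)) (PiM I (\<lambda>_. N)) (\<lambda>x. \<lambda>i\<in>I. f (x i))
     = distr (PiM I (\<lambda>_. M)) (PiM I (\<lambda>_. distr M N f)) (compose I f)"
    by (intro distr_cong sets_PiM_cong) (auto simp: compose_def)
  also have "\<dots> = PiM I (\<lambda>_. distr M (distr M N f) f)"
    using assms by (intro distr_PiM_finite_prob_space') (auto intro: M.prob_space_distr)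
  also have "\<dots> = PiM I (\<lambda>i. distr (PiM I (\<lambda>_. M)) N (\<lambda>x. f (x i)))"
    by (intro PiM_cong) (auto simp: coord intro: distr_cong)
  finally show ?thesis
    using assms by (subst P.indep_vars_iff_distr_eq_PiM') 
      (auto intro: measurable_compose[OF measurable_component_singleton[where M = "\<lambda>_. M"] f])
qed

text \<open>The sums are measurable functions of disjoint blocks of an independent family.\<close>

lemma (in prob_space) indep_var_sums:
  fixes X :: "'i \<Rightarrow> 'a \<Rightarrow> real"
  assumes "indep_vars (\<lambda>_. borel) X I" "A \<inter> B = {}" "A \<subseteq> I" "B \<subseteq> I"
  shows "indep_var borel (\<lambda>\<omega>. \<Sum>i\<in>A. X i \<omega>) borel (\<lambda>\<omega>. \<Sum>i\<in>B. X i \<omega>)"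
proof -
  have "indep_var
    borel ((\<lambda>f. \<Sum>i\<in>A. f i) \<circ> (\<lambda>\<omega>. restrict (\<lambda>i. X i \<omega>) A))
    borel ((\<lambda>f. \<Sum>i\<in>B. f i) \<circ> (\<lambda>\<omega>. restrict (\<lambda>i. X i \<omega>) B))"
    by (intro indep_var_compose[OF indep_var_restrict[OF assms]]) auto
  also have "((\<lambda>f. \<Sum>i\<in>A. f i) \<circ> (\<lambda>\<omega>. restrict (\<lambda>i. X i \<omega>) A)) = (\<lambda>\<omega>. \<Sum>i\<in>A. X i \<omega>)"
    by auto
  also have "((\<lambda>f. \<Sum>i\<in>B. f i) \<circ> (\<lambda>\<omega>. restrict (\<lambda>i. X i \<omega>) B)) = (\<lambda>\<omega>. \<Sum>i\<in>B. X i \<omega>)"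
    by auto
  finally show ?thesis .
qed

text \<open>Almost surely the logarithms of the two moduli are \<open>- U\<close> and
  \<open>- V\<close>, so the integrand is \<open>ln 2 + min U V\<close>.\<close>

lemma nn_integral_max_prods:
  fixes m n :: nat
  defines "P \<equiv> PiM {..<Suc m + Suc n} (\<lambda>_. unit_disk)"
  shows "(\<integral>\<^sup>+x. ennreal (ln 2 - ln (max (cmod (\<Prod>i<Suc m. x i)) (cmod (\<Prod>j<Suc n. x (Suc m + j))))) \<partial>P)
     = ennreal (ln 2 + binom_box_sum (Suc m) (Suc n))"
proof -
  interpret P: prob_space P
    unfolding P_def by (rule prob_space_PiM) (rule unit_disk.prob_space_axioms)
  define E where "E = (\<lambda>i (x::nat \<Rightarrow> complex). - ln (cmod (x i)))"
  define U where "U = (\<lambda>x. \<Sum>i<Suc m. E i x)"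
  define V where "V = (\<lambda>x. \<Sum>i\<in>{Suc m..<Suc m + Suc n}. E i x)"
  have ind: "P.indep_vars (\<lambda>_. borel) E {..<Suc m + Suc n}"
    unfolding P_def E_def
    by (rule indep_vars_PiM_compose[where f = "\<lambda>z. - ln (cmod z)"])
      (use unit_disk.prob_space_axioms distributed_measurable[OF distributed_neg_ln_cmod] in auto)
  have indUV: "P.indep_var borel U borel V"
    unfolding U_def V_def by (rule P.indep_var_sums[OF ind]) auto
  have expE: "distributed P lborel (E i) (exponential_density 2)" if "i < Suc m + Suc n" for i
    unfolding P_def E_def by (rule distributed_neg_ln_coord) (use that in simp)
  \<comment> \<open>The index of \<open>erlang_density\<close> is the shape minus one, so
    \<open>Suc m\<close> exponential summands give index \<open>m\<close>.\<close>
  have U: "distributed P lborel U (erlang_density m 2)"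
    using P.exponential_distributed_sum[of "{..<Suc m}" 2 E] P.indep_vars_subset[OF ind, of "{..<Suc m}"] expE
    by (simp add: U_def lessThan_empty_iff)
  have V: "distributed P lborel V (erlang_density n 2)"
    using P.exponential_distributed_sum[of "{Suc m..<Suc m + Suc n}" 2 E]
      P.indep_vars_subset[OF ind, of "{Suc m..<Suc m + Suc n}"] expE
    by (simp add: V_def subset_eq del: sum.op_ivl_Suc)
  note [measurable] = P.indep_var_rv1[OF indUV] P.indep_var_rv2[OF indUV]
  \<comment> \<open>Nonzero coordinates are needed to turn the logarithm of a product into a
    sum.\<close>
  have ne0: "AE x in P. \<forall>i\<in>{..<Suc m + Suc n}. x i \<noteq> 0"
    unfolding P_def
    by (intro AE_finite_allI AE_PiM_component AE_unit_disk_neq_0 unit_disk.prob_space_axioms) auto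
  \<comment> \<open>Nonnegativity lets \<open>ennreal\<close> be split over the sum with
    \<open>ln 2\<close> without truncation.\<close>
  have nn: "0 \<le> U x" "0 \<le> V x" if "x \<in> space P" for x
  proof -
    have "0 \<le> E i x" if "i < Suc m + Suc n" for i
    proof -
      have "cmod (x i) \<le> 1"
        using \<open>x \<in> space P\<close> that by (auto simp: P_def space_PiM PiE_iff)
      then show ?thesis by (cases "x i = 0") (auto simp: E_def)
    qed
    then show "0 \<le> U x" "0 \<le> V x" unfolding U_def V_def by (auto intro!: sum_nonneg simp del: sum.lessThan_Suc sum.op_ivl_Suc)
  qed
  have "(\<integral>\<^sup>+x. ennreal (ln 2 - ln (max (cmod (\<Prod>i<Suc m. x i)) (cmod (\<Prod>j<Suc n. x (Suc m + j))))) \<partial>P)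
     = (\<integral>\<^sup>+x. ennreal (ln 2) + ennreal (min (U x) (V x)) \<partial>P)"
  proof (rule nn_integral_cong_AE)
    show "AE x in P. ennreal (ln 2 - ln (max (cmod (\<Prod>i<Suc m. x i)) (cmod (\<Prod>j<Suc n. x (Suc m + j)))))
       = ennreal (ln 2) + ennreal (min (U x) (V x))"
      using ne0 AE_space
    proof eventually_elim
      case (elim x)
      have lnprod: "ln (cmod (\<Prod>i\<in>A. x i)) = - (\<Sum>i\<in>A. E i x)" "cmod (\<Prod>i\<in>A. x i) > 0"
        if "finite A" "A \<subseteq> {..<Suc m + Suc n}" for A
        using that elim(1) by (auto simp: prod_norm[symmetric] E_def sum_negf ln_prod subset_eq intro!: prod_pos)
      have shift: "(\<Prod>j<Suc n. x (Suc m + j)) = (\<Prod>i\<in>{Suc m..<Suc m + Suc n}. x i)"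
        by (rule prod.reindex_bij_witness[of _ "\<lambda>i. i - Suc m" "\<lambda>j. Suc m + j"]) auto
      have ln_max: "ln (max u v) = max (ln u) (ln v)" if "u > 0" "v > 0" for u v :: real
        using that by (simp add: max_def)
      have "ln (max (cmod (\<Prod>i<Suc m. x i)) (cmod (\<Prod>j<Suc n. x (Suc m + j))))
         = max (ln (cmod (\<Prod>i<Suc m. x i))) (ln (cmod (\<Prod>j<Suc n. x (Suc m + j))))"
        unfolding shift by (intro ln_max lnprod(2)) auto
      also have "\<dots> = - min (U x) (V x)"
        unfolding shift U_def V_def
        by (subst lnprod(1), simp, force, subst lnprod(1), simp, force) (simp add: max_def min_def)
      finally show ?case
        using nn[OF elim(2)] by (subst ennreal_plus[symmetric]) (auto simp: min_def)
    qed
  qed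
  also have "\<dots> = ennreal (ln 2) + (\<integral>\<^sup>+x. ennreal (min (U x) (V x)) \<partial>P)"
    by (subst nn_integral_add) (auto simp: P.emeasure_space_1)
  also have "\<dots> = ennreal (ln 2) + ennreal (binom_box_sum (Suc m) (Suc n))"
    by (simp only: nn_integral_min_erlang[OF P.prob_space_axioms indUV U V])
  also have "\<dots> = ennreal (ln 2 + binom_box_sum (Suc m) (Suc n))"
    by (simp add: binom_box_sum_nonneg)
  finally show ?thesis .
qed

section \<open>The areal Mahler measure\<close>

text \<open>The maximum replaces the sum under the unnormalised measure, the Gamma computation
  evaluates the normalised integral, and the constant \<open>ln 2\<close> is finally removed.
  Successors keep both blocks of variables nonempty.\<close>

lemma areal_mahler_eq:
  "areal_mahler (Suc m + Suc n) (\<lambda>x. (\<Prod>i<Suc m. x i) + (\<Prod>j<Suc n. x (Suc m + j))) = - binom_box_sum (Suc m) (Suc n)"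
proof -
  define k where "k = Suc m + Suc n"
  define D where "D = PiM {..<k} (\<lambda>_. disk_measure)"
  define f where "f = (\<lambda>x::nat \<Rightarrow> complex. cmod ((\<Prod>i<Suc m. x i) + (\<Prod>j<Suc n. x (Suc m + j))))"
  interpret S: product_sigma_finite "\<lambda>_::nat. disk_measure" by standard
  have "emeasure D (space D) = (\<Prod>i<k. emeasure disk_measure (cball 0 1))"
    unfolding D_def space_PiM space_disk_measure
    by (rule S.emeasure_PiM) (use sets.top[of disk_measure] in simp_all)
  then have D_space: "emeasure D (space D) = ennreal (pi ^ k)"
    by (simp add: emeasure_disk_measure_space ennreal_power)
  interpret D: finite_measure D by standard (simp add: D_space)
  have f_meas[measurable]: "f \<in> borel_measurable D"
    unfolding f_def D_def k_def by measurable
  have nonneg: "0 \<le> ln 2 - ln (f x)" if "x \<in> space D" for x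
  proof -
    have "f x \<le> cmod (\<Prod>i<Suc m. x i) + cmod (\<Prod>j<Suc n. x (Suc m + j))"
      unfolding f_def by (rule norm_triangle_ineq)
    moreover have "cmod (\<Prod>i<Suc m. x i) \<le> 1" "cmod (\<Prod>j<Suc n. x (Suc m + j)) \<le> 1"
      using cmod_prod_le_1[OF that[unfolded D_def], of "{..<Suc m}" "\<lambda>i. i"]
        cmod_prod_le_1[OF that[unfolded D_def], of "{..<Suc n}" "\<lambda>j. Suc m + j"]
      by (auto simp: k_def simp del: prod.lessThan_Suc)
    ultimately have "f x \<le> 2" by linarith
    then show ?thesis by (cases "f x = 0") (auto simp: f_def)
  qed
  have scale: "PiM {..<k} (\<lambda>_. unit_disk) = scale_measure (ennreal ((1 / pi) ^ k)) D"
    unfolding D_def using PiM_disk_measure_eq[of "{..<k}"] by simp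
  define I where "I = (\<integral>\<^sup>+x. ennreal (ln 2 - ln (f x)) \<partial>D)"
  have "I = (\<integral>\<^sup>+x. ennreal (ln 2 - ln (max (cmod (\<Prod>i<Suc m. x i)) (cmod (\<Prod>j<Suc n. x (Suc m + j))))) \<partial>D)"
    unfolding I_def D_def k_def f_def by (rule nn_integral_prods_max)
  moreover have "ennreal ((1 / pi) ^ k) * \<dots>
     = (\<integral>\<^sup>+x. ennreal (ln 2 - ln (max (cmod (\<Prod>i<Suc m. x i)) (cmod (\<Prod>j<Suc n. x (Suc m + j)))))
         \<partial>PiM {..<k} (\<lambda>_. unit_disk))"
    unfolding scale
    by (rule nn_integral_scale_measure[symmetric]) (unfold D_def k_def, measurable)
  ultimately have "ennreal ((1 / pi) ^ k) * I = ennreal (ln 2 + binom_box_sum (Suc m) (Suc n))"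
    using nn_integral_max_prods[of m n] by (simp add: k_def)
  then have "ennreal (pi ^ k) * (ennreal ((1 / pi) ^ k) * I) = ennreal (pi ^ k * (ln 2 + binom_box_sum (Suc m) (Suc n)))"
    by (simp add: ennreal_mult')
  then have I_eq: "I = ennreal (pi ^ k * (ln 2 + binom_box_sum (Suc m) (Suc n)))"
    by (simp add: mult.assoc[symmetric] ennreal_mult''[symmetric] power_mult_distrib[symmetric])
  \<comment> \<open>Finiteness of the nonnegative integral yields integrability, so the integral in
    \<open>areal_mahler\<close> is a genuine one and not the default value 0.\<close>
  have "has_bochner_integral D (\<lambda>x. ln 2 - ln (f x)) (pi ^ k * (ln 2 + binom_box_sum (Suc m) (Suc n)))"
    using nonneg binom_box_sum_nonneg I_eq unfolding I_def
    by (intro has_bochner_integral_nn_integral) auto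
  moreover have "has_bochner_integral D (\<lambda>x. ln 2) (pi ^ k * ln 2)"
    by (simp add: has_bochner_integral_iff measure_def D_space)
  ultimately have "has_bochner_integral D (\<lambda>x. ln 2 - (ln 2 - ln (f x))) (pi ^ k * ln 2 - pi ^ k * (ln 2 + binom_box_sum (Suc m) (Suc n)))"
    by (rule has_bochner_integral_diff[rotated])
  then have "(\<integral>x. ln (f x) \<partial>D) = - (pi ^ k * binom_box_sum (Suc m) (Suc n))"
    by (simp add: has_bochner_integral_iff distrib_left)
  then show ?thesis
    unfolding areal_mahler_def k_def[symmetric] D_def[symmetric] f_def by simp
qed

theorem theorem2p2:
  shows "(\<forall>m::nat. m \<ge> 1 \<longrightarrow>
           areal_mahler (m + 1) (\<lambda>x. (\<Prod>i<m. x i) + x m)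
             = 1 / 2 ^ (m + 1) - 1 / 2)
       \<and> (\<forall>m n::nat. m \<ge> 2 \<longrightarrow> n \<ge> 2 \<longrightarrow>
           areal_mahler (m + n) (\<lambda>x. (\<Prod>i<m. x i) + (\<Prod>j<n. x (m + j)))
             = 1 / 4 + real ((m + n - 2) choose (m - 1)) / 2 ^ (m + n)
               - (1 / 2 ^ (m + n)) * (\<Sum>r<n. real ((m + n - 3 - r) choose (m - 2)) * 2 ^ r)
               - (1 / 2 ^ (m + n)) * (\<Sum>r<m. real ((m + n - 3 - r) choose (n - 2)) * 2 ^ r)
               - (real m / 2 ^ (m + n + 1)) * (\<Sum>r<n. real ((m + n - 1 - r) choose m) * 2 ^ r)
               - (real n / 2 ^ (m + n + 1)) * (\<Sum>r<m. real ((m + n - 1 - r) choose n) * 2 ^ r))"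
proof (intro conjI allI impI)
  fix m :: nat assume "m \<ge> 1"
  then obtain m' where m: "m = Suc m'" by (cases m) auto
  \<comment> \<open>The instance \<open>n = 0\<close> gives a second block with the single variable
    \<open>x m\<close>.\<close>
  have "areal_mahler (m + 1) (\<lambda>x. (\<Prod>i<m. x i) + x m) = - binom_box_sum m 1"
    using areal_mahler_eq[of m' 0] unfolding m by simp
  then show "areal_mahler (m + 1) (\<lambda>x. (\<Prod>i<m. x i) + x m) = 1 / 2 ^ (m + 1) - 1 / 2"
    by (simp only: binom_box_sum_one)
next
  fix m n :: nat assume mn: "m \<ge> 2" "n \<ge> 2"
  then obtain m' n' where "m = Suc m'" "n = Suc n'" by (cases m; cases n) auto
  then have "areal_mahler (m + n) (\<lambda>x. (\<Prod>i<m. x i) + (\<Prod>j<n. x (m + j))) = - binom_box_sum m n"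
    by (simp only: areal_mahler_eq)
  also note binom_box_sum_closed[OF mn]
  finally show "areal_mahler (m + n) (\<lambda>x. (\<Prod>i<m. x i) + (\<Prod>j<n. x (m + j)))
             = 1 / 4 + real ((m + n - 2) choose (m - 1)) / 2 ^ (m + n)
               - (1 / 2 ^ (m + n)) * (\<Sum>r<n. real ((m + n - 3 - r) choose (m - 2)) * 2 ^ r)
               - (1 / 2 ^ (m + n)) * (\<Sum>r<m. real ((m + n - 3 - r) choose (n - 2)) * 2 ^ r)
               - (real m / 2 ^ (m + n + 1)) * (\<Sum>r<n. real ((m + n - 1 - r) choose m) * 2 ^ r)
               - (real n / 2 ^ (m + n + 1)) * (\<Sum>r<m. real ((m + n - 1 - r) choose n) * 2 ^ r)" .
qed
end
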